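(* Let $\lambda=(\lambda_1,\dots,\lambda_k)$ be a composition of $n$, $\mathfrak s$ a row standard $\lambda$-tableau, $d=d(\mathfrak s)$, and $J=J(\mathfrak s)$, $L=L(\mathfrak s)$, $K=K(\mathfrak s)$. Let $(i,j)\in K$, $\alpha\in\mathbb F_q$, $A\in V_J$. Then $$e_{dA}\,x_{ij}(\alpha)=\begin{cases}\theta(A_{ij}\alpha)\,e_{dB}&\text{for }(i,j)\in J,\\ e_{dB}&\text{for }(i,j)\in L,\end{cases}$$ where: if $(i,j)\in J$, $dB$ is obtained from $dA$ by adding $-\alpha$ times column $j$ to column $i$ of $dA$ and setting to zero all entries of the resulting matrix at positions which do not belong to $J$; if $(i,j)\in L$, $dB$ is obtained similarly by the combined truncated row and column operation, i.e. by adding $-\alpha$ times column $j$ to column $i$ and $\alpha$ times row $i$ to row $j$ and then setting to zero all entries at positions which do not belong to $J$. Moreover, if $(i,j)\in L$ belongs to the highest compartment, i.e. $\mathrm{row}_{\mathfrak s}(i)=\mathrm{row}_{\mathfrak s}(j)=1$ (respectively to the lowest compartment, i.e. $\mathrm{row}_{\mathfrak s}(i)=\mathrm{row}_{\mathfrak s}(j)=k$), then $x_{ij}(\alpha)$ acts by the truncated column operation (respectively the truncated row operation) alone.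
   Context: $\mathbb F_q$ is the field with $q$ elements, $M_n(q)$ the algebra of $n\times n$-matrices over $\mathbb F_q$, $E$ the identity matrix, $e_{ij}$ the matrix units, $x_{ij}(\alpha)=E+\alpha e_{ij}$, $\Phi^-=\{(i,j):1\leq j<i\leq n\}$. For $S\subseteq\Phi^-$, $V_S$ is the set of $A\in M_n(q)$ whose nonzero entries lie at positions in $S$; for $S$ closed ($(i,j),(j,k)\in S\Rightarrow(i,k)\in S$), $U_S=\{E+A:A\in V_S\}$ is a group. A composition $\lambda=(\lambda_1,\dots,\lambda_k)$ of $n$ is a sequence of nonnegative integers with sum $n$. A $\lambda$-tableau is a bijective filling of the Young diagram of $\lambda$ with $1,\dots,n$; it is row standard if entries increase along rows. $\mathrm{row}_{\mathfrak s}(i)$ is the index (from the top) of the row of $\mathfrak s$ containing $i$. $\mathfrak t^\lambda$ is the tableau with $1,\dots,n$ inserted in order along the rows, top to bottom; $d(\mathfrak s)$ is the permutation $d$ with $\mathfrak t^\lambda d=\mathfrak s$ (permutations act from the right on entries), identified with the permutation matrix having entry $1$ at the positions $(a,ad)$. Put $J(\mathfrak s)=\{(i,j)\in\Phi^-:\mathrm{row}_{\mathfrak s}(i)>\mathrm{row}_{\mathfrak s}(j)\}$, $L(\mathfrak s)=\{(i,j)\in\Phi^-:\mathrm{row}_{\mathfrak s}(i)=\mathrm{row}_{\mathfrak s}(j)\}$, $K(\mathfrak s)=J(\mathfrak s)\cup L(\mathfrak s)$. These are closed, $U_J\trianglelefteq U_K$ and $U_K=U_J\rtimes U_L$. Fix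 a nontrivial linear character $\theta:(\mathbb F_q,+)\to\mathbb C^*$ and for $A,B\in V_J$ put $\chi_A(B)=\theta(\sum_{(i,j)\in J}A_{ij}B_{ij})$; $\{\chi_A:A\in V_J\}$ is the set of all linear characters of $(V_J,+)$. The lidempotents $e_A=q^{-|J|}\sum_{B\in V_J}\overline{\chi_A(B)}\,B$ ($A\in V_J$) form a basis of the group algebra $\mathbb C(V_J,+)$. The latter is a right $\mathbb CU_K$-module as follows: let $\rho:U_K\to U_L$ be the projection with kernel $U_J$, let $A\circ g=\rho(g^{-1})Ag$ for $A\in V_J$, $g\in U_K$, and let $f(g)=\rho(g^{-1})g-E\in V_J$; identifying $\mathbb C(V_J,+)$ with the functions $V_J\to\mathbb C$ via $\tau\mapsto\sum_B\tau(B)B$, the action is determined on linear characters $\chi$ by $\chi g=\chi(f(g^{-1}))\,\chi.g$ with $(\chi.g)(B)=\chi(B\circ g^{-1})$. For $A\in V_J$ the matrix $dA$ arises from $A$ by reordering rows; its rows are relabelled top down by $1d,\dots,nd$, so that the row of $dA$ labelled $i$ is row $i$ of $A$ and the entry at position $(i,j)$ of $dA$ in this labelling is $A_{ij}$. The rows of $dA$ are divided into compartments corresponding to the rows of $\mathfrak s$. "Row $i$" and "position $(i,j)$" of $dA$ always refer to this labelling. Left multiplication by $d$ extends linearly to an isomorphism from $\mathbb C(V_J,+)$ to $\mathbb C(\mathfrak X^0_{\mathfrak s},+)$, $\mathfrak X^0_{\mathfrak s}=dV_J$; $e_{dA}$ denotes the image of $e_A$, and the $U_K$-action is transported along this isomorphism.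 The resulting $\mathbb CU_K$-module is isomorphic to the restriction to $U_K$ of the $\mathfrak s$-component $M_{\mathfrak s}=\overline{P_\lambda}\,d\,\mathbb CU$ of the permutation module of $GL_n(q)$ on $\lambda$-flags. *)

theory Defs
  imports
    "HOL-Library.Cardinality"
    "HOL-Combinatorics.Permutations"
    "Jordan_Normal_Form.Column_Operations"
begin

text \<open>All indices start at 0 here: matrix rows and columns, tableau entries, and rows and columns
  of a diagram. So entries and positions range over \<open>{..<n}\<close> instead of \<open>{1..n}\<close>, the top row of a
  \<open>\<lambda>\<close>-tableau is row 0 and the bottom one is row \<open>length \<lambda> - 1\<close>. The field with q elements is a type
  \<open>'a :: {finite, field}\<close>, with \<open>q = CARD('a)\<close>.\<close>

section \<open>Pattern subgroups\<close>

definition neg_roots :: "nat \<Rightarrow> (nat \<times> nat) set" where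
  "neg_roots n = {(i, j). j < i \<and> i < n}"

definition pattern_space :: "nat \<Rightarrow> (nat \<times> nat) set \<Rightarrow> 'a :: field mat set" where
  "pattern_space n S =
    {A \<in> carrier_mat n n. \<forall>i<n. \<forall>j<n. A $$ (i, j) \<noteq> 0 \<longrightarrow> (i, j) \<in> S}"

definition pattern_group :: "nat \<Rightarrow> (nat \<times> nat) set \<Rightarrow> 'a :: field mat set" where
  "pattern_group n S = {1\<^sub>m n + A | A. A \<in> pattern_space n S}"

definition matrix_unit :: "nat \<Rightarrow> nat \<Rightarrow> nat \<Rightarrow> 'a :: field mat" where
  "matrix_unit n i j = mat n n (\<lambda>(a, b). if a = i \<and> b = j then 1 else 0)"

definition root_elt :: "nat \<Rightarrow> nat \<Rightarrow> nat \<Rightarrow> 'a :: field \<Rightarrow> 'a mat" where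
  "root_elt n i j \<alpha> = 1\<^sub>m n + \<alpha> \<cdot>\<^sub>m matrix_unit n i j"

definition minv :: "nat \<Rightarrow> 'a :: field mat \<Rightarrow> 'a mat" where
  "minv n g = inv\<^bsub>ring_mat TYPE('a) n ()\<^esub> g"

section \<open>Tableaux\<close>

text \<open>A composition \<open>\<lambda>\<close> of n is a list of natural numbers with sum n. A tableau is a function on
  boxes (row, column); its values outside the diagram are irrelevant.\<close>

definition diagram :: "nat list \<Rightarrow> (nat \<times> nat) set" where
  "diagram lam = {(r, c). r < length lam \<and> c < lam ! r}"

definition is_tableau :: "nat list \<Rightarrow> (nat \<times> nat \<Rightarrow> nat) \<Rightarrow> bool" where
  "is_tableau lam s \<longleftrightarrow> bij_betw s (diagram lam) {..<sum_list lam}"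

definition row_standard :: "nat list \<Rightarrow> (nat \<times> nat \<Rightarrow> nat) \<Rightarrow> bool" where
  "row_standard lam s \<longleftrightarrow> is_tableau lam s \<and>
    (\<forall>r c c'. (r, c) \<in> diagram lam \<and> (r, c') \<in> diagram lam \<and> c < c' \<longrightarrow> s (r, c) < s (r, c'))"

definition tab_row :: "nat list \<Rightarrow> (nat \<times> nat \<Rightarrow> nat) \<Rightarrow> nat \<Rightarrow> nat" where
  "tab_row lam s i = (THE r. \<exists>c. (r, c) \<in> diagram lam \<and> s (r, c) = i)"

definition initial_tableau :: "nat list \<Rightarrow> nat \<times> nat \<Rightarrow> nat" where
  "initial_tableau lam = (\<lambda>(r, c). sum_list (take r lam) + c)"

text \<open>The permutation d with \<open>t\<^sup>\<lambda> d = s\<close>; the right action on entries sends a to \<open>d a\<close>.\<close>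

definition tab_perm :: "nat list \<Rightarrow> (nat \<times> nat \<Rightarrow> nat) \<Rightarrow> nat \<Rightarrow> nat" where
  "tab_perm lam s = (THE d. d permutes {..<sum_list lam} \<and>
    (\<forall>b \<in> diagram lam. d (initial_tableau lam b) = s b))"

definition perm_matrix :: "nat \<Rightarrow> (nat \<Rightarrow> nat) \<Rightarrow> 'a :: field mat" where
  "perm_matrix n d = mat n n (\<lambda>(a, b). if b = d a then 1 else 0)"

definition J_set :: "nat list \<Rightarrow> (nat \<times> nat \<Rightarrow> nat) \<Rightarrow> (nat \<times> nat) set" where
  "J_set lam s = {(i, j) \<in> neg_roots (sum_list lam). tab_row lam s i > tab_row lam s j}"

definition L_set :: "nat list \<Rightarrow> (nat \<times> nat \<Rightarrow> nat) \<Rightarrow> (nat \<times> nat) set" where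
  "L_set lam s = {(i, j) \<in> neg_roots (sum_list lam). tab_row lam s i = tab_row lam s j}"

definition K_set :: "nat list \<Rightarrow> (nat \<times> nat \<Rightarrow> nat) \<Rightarrow> (nat \<times> nat) set" where
  "K_set lam s = J_set lam s \<union> L_set lam s"

section \<open>Characters and lidempotents\<close>

text \<open>The group algebra of a finite additive group V of matrices is the space of complex functions
  on V; such a function is extended by 0 to all matrices, and \<open>\<tau>\<close> stands for the sum of
  \<open>\<tau>(B) B\<close> over B in V.\<close>

definition group_alg :: "'a mat set \<Rightarrow> ('a mat \<Rightarrow> complex) set" where
  "group_alg V = {\<tau>. \<forall>B. B \<notin> V \<longrightarrow> \<tau> B = 0}"

definition linear_char :: "'b :: plus set \<Rightarrow> ('b \<Rightarrow> complex) \<Rightarrow> bool" where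
  "linear_char V \<chi> \<longleftrightarrow>
    (\<forall>A\<in>V. \<chi> A \<noteq> 0) \<and> (\<forall>A\<in>V. \<forall>B\<in>V. \<chi> (A + B) = \<chi> A * \<chi> B)"

definition chi :: "('a :: field \<Rightarrow> complex) \<Rightarrow> nat \<Rightarrow> (nat \<times> nat) set
    \<Rightarrow> 'a mat \<Rightarrow> 'a mat \<Rightarrow> complex" where
  "chi \<theta> n J A = (\<lambda>B. if B \<in> pattern_space n J
    then \<theta> (\<Sum>(i, j)\<in>J. A $$ (i, j) * B $$ (i, j)) else 0)"

definition lidem :: "('a :: {finite, field} \<Rightarrow> complex) \<Rightarrow> nat \<Rightarrow> (nat \<times> nat) set
    \<Rightarrow> 'a mat \<Rightarrow> 'a mat \<Rightarrow> complex" where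
  "lidem \<theta> n J A = (\<lambda>B. cnj (chi \<theta> n J A B) / of_nat CARD('a) ^ card J)"

section \<open>The monomial action\<close>

text \<open>In what follows \<open>U\<^sub>K\<close> is the semidirect product of the normal subgroup \<open>U\<^sub>J\<close> and \<open>U\<^sub>L\<close>;
  \<open>projL\<close> is the projection onto \<open>U\<^sub>L\<close> with kernel \<open>U\<^sub>J\<close>.\<close>

definition projL :: "nat \<Rightarrow> (nat \<times> nat) set \<Rightarrow> (nat \<times> nat) set \<Rightarrow> 'a :: field mat \<Rightarrow> 'a mat" where
  "projL n J L g = (THE h. h \<in> pattern_group n L \<and> (\<exists>u \<in> pattern_group n J. g = u * h))"

definition circ :: "nat \<Rightarrow> (nat \<times> nat) set \<Rightarrow> (nat \<times> nat) set
    \<Rightarrow> 'a :: field mat \<Rightarrow> 'a mat \<Rightarrow> 'a mat" where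
  "circ n J L A g = projL n J L (minv n g) * A * g"

definition cocycle :: "nat \<Rightarrow> (nat \<times> nat) set \<Rightarrow> (nat \<times> nat) set \<Rightarrow> 'a :: field mat \<Rightarrow> 'a mat" where
  "cocycle n J L g = projL n J L (minv n g) * g - 1\<^sub>m n"

definition char_dot :: "nat \<Rightarrow> (nat \<times> nat) set \<Rightarrow> (nat \<times> nat) set
    \<Rightarrow> ('a :: field mat \<Rightarrow> complex) \<Rightarrow> 'a mat \<Rightarrow> 'a mat \<Rightarrow> complex" where
  "char_dot n J L \<chi> g =
    (\<lambda>B. if B \<in> pattern_space n J then \<chi> (circ n J L B (minv n g)) else 0)"

text \<open>The operator by which \<open>g\<close> acts on the right of the group algebra of \<open>(V\<^sub>J, +)\<close>: the linear one
  with the prescribed values on all linear characters. The characters span, so any two such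
  operators agree on the group algebra; only the irrelevant values outside it are chosen.\<close>

definition is_act_op :: "nat \<Rightarrow> (nat \<times> nat) set \<Rightarrow> (nat \<times> nat) set \<Rightarrow> 'a :: field mat
    \<Rightarrow> (('a mat \<Rightarrow> complex) \<Rightarrow> ('a mat \<Rightarrow> complex)) \<Rightarrow> bool" where
  "is_act_op n J L g T \<longleftrightarrow>
    (let V = pattern_space n J; G = group_alg V in
      T ` G \<subseteq> G \<and>
      (\<forall>\<sigma>\<in>G. \<forall>\<tau>\<in>G. T (\<lambda>B. \<sigma> B + \<tau> B) = (\<lambda>B. T \<sigma> B + T \<tau> B)) \<and>
      (\<forall>c. \<forall>\<tau>\<in>G. T (\<lambda>B. c * \<tau> B) = (\<lambda>B. c * T \<tau> B)) \<and>
      (\<forall>\<chi>\<in>G. linear_char V \<chi> \<longrightarrow>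
        T \<chi> = (\<lambda>B. \<chi> (cocycle n J L (minv n g)) * char_dot n J L \<chi> g B)))"

definition act :: "nat \<Rightarrow> (nat \<times> nat) set \<Rightarrow> (nat \<times> nat) set
    \<Rightarrow> ('a :: field mat \<Rightarrow> complex) \<Rightarrow> 'a mat \<Rightarrow> ('a mat \<Rightarrow> complex)" where
  "act n J L \<tau> g = (SOME T. is_act_op n J L g T) \<tau>"

section \<open>Transport along left multiplication by d\<close>

definition left_mult :: "'a :: {finite, field} mat set \<Rightarrow> 'a mat
    \<Rightarrow> ('a mat \<Rightarrow> complex) \<Rightarrow> ('a mat \<Rightarrow> complex)" where
  "left_mult V D \<tau> = (\<lambda>X. \<Sum>B | B \<in> V \<and> D * B = X. \<tau> B)"

definition tab_matrix :: "nat list \<Rightarrow> (nat \<times> nat \<Rightarrow> nat) \<Rightarrow> 'a :: field mat" where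
  "tab_matrix lam s = perm_matrix (sum_list lam) (tab_perm lam s)"

text \<open>For A in \<open>V\<^sub>J\<close>, \<open>lidem_tab \<theta> lam s A\<close> is \<open>e\<close> indexed by dA.\<close>

definition lidem_tab :: "('a :: {finite, field} \<Rightarrow> complex) \<Rightarrow> nat list \<Rightarrow> (nat \<times> nat \<Rightarrow> nat)
    \<Rightarrow> 'a mat \<Rightarrow> 'a mat \<Rightarrow> complex" where
  "lidem_tab \<theta> lam s A =
    left_mult (pattern_space (sum_list lam) (J_set lam s)) (tab_matrix lam s)
      (lidem \<theta> (sum_list lam) (J_set lam s) A)"

definition act_tab :: "nat list \<Rightarrow> (nat \<times> nat \<Rightarrow> nat)
    \<Rightarrow> ('a :: {finite, field} mat \<Rightarrow> complex) \<Rightarrow> 'a mat \<Rightarrow> ('a mat \<Rightarrow> complex)" where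
  "act_tab lam s \<tau> g =
    (let V = pattern_space (sum_list lam) (J_set lam s);
         \<phi> = left_mult V (tab_matrix lam s)
     in \<phi> (act (sum_list lam) (J_set lam s) (L_set lam s) (the_inv_into (group_alg V) \<phi> \<tau>) g))"

section \<open>Operations on dA\<close>

text \<open>Row a of \<open>X = dA\<close> carries the label \<open>d a\<close>, so row label i sits in row \<open>inv d i\<close>; column labels
  are ordinary column indices. \<open>lab_addcol c j i X\<close> adds c times column j to column i and
  \<open>lab_addrow lam s c i j X\<close> adds c times the row labelled i to the row labelled j. (The arguments
  of the library's \<open>addcol\<close> and \<open>addrow\<close> are in the order target, source.)\<close>

definition lab_addcol :: "'a :: field \<Rightarrow> nat \<Rightarrow> nat \<Rightarrow> 'a mat \<Rightarrow> 'a mat" where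
  "lab_addcol c j i X = addcol c i j X"

definition lab_addrow :: "nat list \<Rightarrow> (nat \<times> nat \<Rightarrow> nat) \<Rightarrow> 'a :: field
    \<Rightarrow> nat \<Rightarrow> nat \<Rightarrow> 'a mat \<Rightarrow> 'a mat" where
  "lab_addrow lam s c i j X =
    addrow c (inv_into UNIV (tab_perm lam s) j) (inv_into UNIV (tab_perm lam s) i) X"

definition lab_trunc :: "nat list \<Rightarrow> (nat \<times> nat \<Rightarrow> nat) \<Rightarrow> 'a :: field mat \<Rightarrow> 'a mat" where
  "lab_trunc lam s X = mat (sum_list lam) (sum_list lam)
    (\<lambda>(a, b). if (tab_perm lam s a, b) \<in> J_set lam s then X $$ (a, b) else 0)"

end

theory Submission
  imports Defs
begin

text \<open>The action of g on the group algebra of \<open>V\<^sub>J\<close> is pullback along the affine map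
  \<open>B \<mapsto> \<rho>(g) B g\<^sup>-\<^sup>1 + f(g\<^sup>-\<^sup>1)\<close>, and \<open>e\<^sub>A\<close> is a multiple of the linear character \<open>\<chi>\<close> with
  index \<open>-A\<close>. The constant part of the affine map yields the scalar. The adjoint of the linear
  part for the bilinear form \<open>tr (A\<^sup>T B)\<close> is \<open>A \<mapsto> \<rho>(g)\<^sup>T A g\<^sup>-\<^sup>T\<close>, followed by truncation to J,
  and for \<open>g = x\<^sub>i\<^sub>j(\<alpha>)\<close> this is the row and column operation. Row operations do nothing in the
  top compartment and column operations do nothing in the bottom one, because the rows
  (columns) concerned contain no position of J.\<close>

section \<open>Pattern spaces and root elements\<close>

lemma pattern_space_carrier: "A \<in> pattern_space n S \<Longrightarrow> A \<in> carrier_mat n n"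
  by (simp add: pattern_space_def)

lemma pattern_space_outside:
  "A \<in> pattern_space n S \<Longrightarrow> a < n \<Longrightarrow> b < n \<Longrightarrow> (a, b) \<notin> S \<Longrightarrow> A $$ (a, b) = 0"
  by (auto simp: pattern_space_def)

lemma pattern_space_zero: "0\<^sub>m n n \<in> pattern_space n S"
  by (simp add: pattern_space_def)

lemma pattern_space_add:
  "A \<in> pattern_space n S \<Longrightarrow> B \<in> pattern_space n S \<Longrightarrow> A + B \<in> pattern_space n S"
  by (fastforce simp: pattern_space_def)

text \<open>A nonzero entry of the product needs a nonzero summand A_ac B_cb, hence a composable
  pair of positions. The target R is a separate set because the products of V_J with V_L, in either
  order, have to land in V_J.\<close>

lemma pattern_space_mult:
  assumes A: "A \<in> pattern_space n S" and B: "B \<in> pattern_space n T"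
    and R: "\<And>i j k. (i, j) \<in> S \<Longrightarrow> (j, k) \<in> T \<Longrightarrow> (i, k) \<in> R"
  shows "A * B \<in> pattern_space n R"
proof -
  note carr = pattern_space_carrier[OF A] pattern_space_carrier[OF B]
  have "(a, b) \<in> R" if ab: "a < n" "b < n" and nz: "(A * B) $$ (a, b) \<noteq> 0" for a b
  proof -
    have "(A * B) $$ (a, b) = (\<Sum>c<n. A $$ (a, c) * B $$ (c, b))"
      using carr ab by (auto simp: scalar_prod_def atLeast0LessThan intro!: sum.cong)
    with nz obtain c where "c < n" "A $$ (a, c) * B $$ (c, b) \<noteq> 0"
      by (metis (no_types, lifting) lessThan_iff sum.neutral)
    then show ?thesis
      using A B ab R[of a c b] by (auto simp: pattern_space_def)
  qed
  then show ?thesis using carr by (auto simp: pattern_space_def)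
qed

lemma matrix_unit_carrier [simp]: "matrix_unit n i j \<in> carrier_mat n n"
  by (simp add: matrix_unit_def)

lemma smult_matrix_unit_pattern:
  "(i, j) \<in> S \<Longrightarrow> \<alpha> \<cdot>\<^sub>m matrix_unit n i j \<in> pattern_space n S"
  by (auto simp: pattern_space_def matrix_unit_def)

lemma root_elt_carrier [simp]: "root_elt n i j \<alpha> \<in> carrier_mat n n"
  by (simp add: root_elt_def)

section \<open>Root elements as elementary matrices\<close>

lemma root_elt_addrow_mat: "root_elt n i j \<alpha> = addrow_mat n \<alpha> i j"
  by (rule eq_matI) (auto simp: root_elt_def matrix_unit_def addrow_mat_def)

lemma transpose_root_elt: "(root_elt n i j \<alpha>)\<^sup>T = root_elt n j i \<alpha>"
  by (rule eq_matI) (auto simp: root_elt_def matrix_unit_def)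

lemma root_elt_mult_left:
  "A \<in> carrier_mat n n \<Longrightarrow> j < n \<Longrightarrow> root_elt n i j \<alpha> * A = addrow \<alpha> i j A"
  by (simp add: root_elt_addrow_mat addrow_mat)

lemma root_elt_mult_right:
  "A \<in> carrier_mat n n \<Longrightarrow> i < n \<Longrightarrow> A * root_elt n i j \<alpha> = addcol \<alpha> j i A"
  by (simp add: root_elt_addrow_mat addcol_mat)

lemma root_elt_inverse:
  assumes "i < n" "j < n" "i \<noteq> j"
  shows "root_elt n i j \<alpha> * root_elt n i j (- \<alpha>) = 1\<^sub>m n"
  using assms by (simp add: root_elt_addrow_mat addrow_mat_inv)

lemma minv_root_elt:
  fixes \<alpha> :: "'a :: field"
  assumes "i < n" "j < n" "i \<noteq> j"
  shows "minv n (root_elt n i j \<alpha>) = root_elt n i j (- \<alpha>)"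
proof -
  \<comment> \<open>\<open>minv\<close> is the inverse in the multiplicative monoid of the matrix
    ring, where a two-sided inverse is unique.\<close>
  interpret semiring "ring_mat TYPE('a) n ()" by (rule semiring_mat)
  show ?thesis
    unfolding minv_def
    using root_elt_inverse[OF assms, of \<alpha>] root_elt_inverse[OF assms, of "- \<alpha>"]
    by (intro inv_unique'[symmetric]) (auto simp: ring_mat_simps)
qed

section \<open>The trace form\<close>

text \<open>This is tr(A^T B). The sum runs over the full square instead of J, so that
  multiplications by arbitrary matrices have adjoints; J enters later through
  \<open>pattern_trunc\<close>.\<close>

definition frob :: "nat \<Rightarrow> 'a :: comm_ring_1 mat \<Rightarrow> 'a mat \<Rightarrow> 'a" where
  "frob n A B = (\<Sum>a<n. \<Sum>b<n. A $$ (a, b) * B $$ (a, b))"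

definition pattern_trunc :: "nat \<Rightarrow> (nat \<times> nat) set \<Rightarrow> 'a :: field mat \<Rightarrow> 'a mat" where
  "pattern_trunc n S A = mat n n (\<lambda>(a, b). if (a, b) \<in> S then A $$ (a, b) else 0)"

lemma pattern_trunc_in: "pattern_trunc n S A \<in> pattern_space n S"
  by (auto simp: pattern_trunc_def pattern_space_def)

text \<open>The entries removed by truncation meet only zeros of B, so truncation is the orthogonal
  projection onto V_S. A character of V_J given by any matrix thus has an index in V_J.\<close>

lemma frob_pattern_trunc:
  "B \<in> pattern_space n S \<Longrightarrow> frob n (pattern_trunc n S A) B = frob n A B"
  unfolding frob_def
  by (intro sum.cong refl) (auto simp: pattern_trunc_def pattern_space_outside)

lemma frob_uminus_left:
  "A \<in> carrier_mat n n \<Longrightarrow> frob n (- A) B = - frob n A B"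
  by (auto simp: frob_def sum_negf intro!: sum.cong)

lemma frob_add_right:
  "B \<in> carrier_mat n n \<Longrightarrow> C \<in> carrier_mat n n \<Longrightarrow> frob n A (B + C) = frob n A B + frob n A C"
  by (auto simp: frob_def sum.distrib ring_distribs intro!: sum.cong)

lemma frob_smult_right:
  "B \<in> carrier_mat n n \<Longrightarrow> frob n A (c \<cdot>\<^sub>m B) = c * frob n A B"
  by (auto simp: frob_def sum_distrib_left intro!: sum.cong)

lemma frob_matrix_unit:
  assumes "i < n" "j < n"
  shows "frob n A (matrix_unit n i j) = A $$ (i, j)"
proof -
  have "frob n A (matrix_unit n i j) = (\<Sum>a<n. \<Sum>b<n. if a = i \<and> b = j then A $$ (a, b) else 0)"
    by (auto simp: frob_def matrix_unit_def intro!: sum.cong)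
  also have "\<dots> = (\<Sum>a<n. if a = i then A $$ (a, j) else 0)"
    using assms by (intro sum.cong) (auto simp: sum.delta)
  finally show ?thesis using assms by simp
qed

section \<open>Adjoints of left and right multiplication\<close>

lemma frob_transpose:
  assumes "A \<in> carrier_mat n n" "B \<in> carrier_mat n n"
  shows "frob n A\<^sup>T B\<^sup>T = frob n A B"
proof -
  have "frob n A\<^sup>T B\<^sup>T = (\<Sum>a<n. \<Sum>b<n. A $$ (b, a) * B $$ (b, a))"
    using assms by (auto simp: frob_def intro!: sum.cong)
  also have "\<dots> = frob n A B" unfolding frob_def by (rule sum.swap)
  finally show ?thesis .
qed

text \<open>Both sides expand to the sum of A_ab h_ac B_cb over a, b, c; only the order of summation
  differs.\<close>

lemma frob_mult_left:
  assumes "A \<in> carrier_mat n n" "B \<in> carrier_mat n n" "h \<in> carrier_mat n n"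
  shows "frob n A (h * B) = frob n (h\<^sup>T * A) B"
proof -
  have "frob n A (h * B) = (\<Sum>a<n. \<Sum>b<n. \<Sum>c<n. A $$ (a, b) * (h $$ (a, c) * B $$ (c, b)))"
    using assms by (auto simp: frob_def scalar_prod_def atLeast0LessThan sum_distrib_left intro!: sum.cong)
  also have "\<dots> = (\<Sum>c<n. \<Sum>b<n. \<Sum>a<n. A $$ (a, b) * (h $$ (a, c) * B $$ (c, b)))"
    by (subst sum.swap, subst (2) sum.swap, subst sum.swap, rule refl)
  also have "\<dots> = frob n (h\<^sup>T * A) B"
    using assms by (auto simp: frob_def scalar_prod_def atLeast0LessThan sum_distrib_left
        sum_distrib_right mult_ac intro!: sum.cong)
  finally show ?thesis .
qed

text \<open>Transposing both arguments turns right multiplication into left multiplication, whose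
  adjoint is known.\<close>

lemma frob_mult_right:
  assumes "A \<in> carrier_mat n n" "B \<in> carrier_mat n n" "k \<in> carrier_mat n n"
  shows "frob n A (B * k) = frob n (A * k\<^sup>T) B"
proof -
  have "frob n A (B * k) = frob n A\<^sup>T (k\<^sup>T * B\<^sup>T)"
    using assms frob_transpose[of A n "B * k"] by (simp add: transpose_mult[of _ n n _ n])
  also have "\<dots> = frob n (k * A\<^sup>T) B\<^sup>T"
    using assms by (subst frob_mult_left) auto
  also have "\<dots> = frob n (A * k\<^sup>T) B"
    using assms frob_transpose[of "A * k\<^sup>T" n B] by (simp add: transpose_mult[of _ n n _ n])
  finally show ?thesis .
qed

section \<open>Linear characters\<close>

lemma linear_char_UNIV_add:
  "linear_char UNIV \<theta> \<Longrightarrow> \<theta> (x + y) = \<theta> x * \<theta> y"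
  by (simp add: linear_char_def)

text \<open>Multiplicativity gives \<theta>(0) = \<theta>(0)^2, and \<theta>(0) is nonzero.\<close>

lemma linear_char_UNIV_zero:
  fixes \<theta> :: "'a :: monoid_add \<Rightarrow> complex"
  assumes "linear_char UNIV \<theta>"
  shows "\<theta> 0 = 1"
  using assms linear_char_UNIV_add[OF assms, of 0 0] by (simp add: linear_char_def)

lemma linear_char_norm:
  fixes \<theta> :: "'a :: {finite, group_add} \<Rightarrow> complex"
  assumes \<theta>: "linear_char UNIV \<theta>"
  shows "norm (\<theta> x) = 1"
proof -
  \<comment> \<open>A maximal value M of the norm satisfies \<open>M\<^sup>2 \<le> M\<close>.\<close>
  define M where "M = Max (range (\<lambda>x. norm (\<theta> x)))"
  have le: "norm (\<theta> y) \<le> M" for y unfolding M_def by (intro Max_ge) auto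
  have "M \<in> range (\<lambda>x. norm (\<theta> x))" unfolding M_def by (intro Max_in) auto
  then obtain z where z: "M = norm (\<theta> z)" by auto
  have "M * M \<le> M"
    using le[of "z + z"] unfolding linear_char_UNIV_add[OF \<theta>] norm_mult z .
  moreover have "M \<ge> 1" using le[of 0] linear_char_UNIV_zero[OF \<theta>] by simp
  ultimately have "M \<le> 1" using mult_le_cancel_left_pos[of M M 1] by simp
  then have le1: "norm (\<theta> y) \<le> 1" for y using le[of y] by linarith
  \<comment> \<open>Two factors that are at most 1 and have product 1 are both equal to 1.\<close>
  have "norm (\<theta> x) * norm (\<theta> (- x)) = 1"
    unfolding norm_mult[symmetric] linear_char_UNIV_add[OF \<theta>, symmetric]
    by (simp add: linear_char_UNIV_zero[OF \<theta>])
  then show ?thesis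
    using le1[of x] le1[of "- x"] mult_left_le[of "norm (\<theta> (- x))" "norm (\<theta> x)"] by simp
qed

text \<open>Both sides are inverse to \<theta>(x): the conjugate because \<theta>(x) has absolute
  value 1, the other by multiplicativity.\<close>

lemma linear_char_cnj:
  fixes \<theta> :: "'a :: {finite, group_add} \<Rightarrow> complex"
  assumes \<theta>: "linear_char UNIV \<theta>"
  shows "cnj (\<theta> x) = \<theta> (- x)"
proof -
  have "\<theta> x * \<theta> (- x) = 1"
    unfolding linear_char_UNIV_add[OF \<theta>, symmetric] by (simp add: linear_char_UNIV_zero[OF \<theta>])
  moreover have "\<theta> x * cnj (\<theta> x) = 1"
    using complex_norm_square[of "\<theta> x"] by (simp add: linear_char_norm[OF \<theta>])
  moreover have "\<theta> x \<noteq> 0" using \<theta> by (simp add: linear_char_def)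
  ultimately show ?thesis by (metis mult_left_cancel)
qed

text \<open>B vanishes outside J, so extending the sum from J to the full square adds only
  zeros.\<close>

lemma chi_frob:
  assumes J: "J \<subseteq> {..<n} \<times> {..<n}" and B: "B \<in> pattern_space n J"
  shows "chi \<theta> n J A B = \<theta> (frob n A B)"
proof -
  have "frob n A B = (\<Sum>(a, b)\<in>{..<n} \<times> {..<n}. A $$ (a, b) * B $$ (a, b))"
    unfolding frob_def by (rule sum.cartesian_product)
  also have "\<dots> = (\<Sum>(a, b)\<in>J. A $$ (a, b) * B $$ (a, b))"
    using J B by (intro sum.mono_neutral_right) (auto simp: pattern_space_outside)
  finally show ?thesis using B by (simp add: chi_def)
qed

lemma chi_in_group_alg: "chi \<theta> n J A \<in> group_alg (pattern_space n J)"
  by (simp add: group_alg_def chi_def)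

lemma linear_char_chi:
  assumes "J \<subseteq> {..<n} \<times> {..<n}" "linear_char UNIV \<theta>"
  shows "linear_char (pattern_space n J) (chi \<theta> n J A)"
  using assms
  by (auto simp: linear_char_def chi_frob pattern_space_add frob_add_right pattern_space_carrier)

text \<open>Conjugation negates the argument of \<theta>, and so the index A. Since the action is
  prescribed on linear characters, this form makes it computable on lidempotents.\<close>

lemma lidem_eq_chi:
  assumes "J \<subseteq> {..<n} \<times> {..<n}" "linear_char UNIV \<theta>" "A \<in> carrier_mat n n"
  shows "lidem \<theta> n J A = (\<lambda>B. 1 / of_nat CARD('a) ^ card J * chi \<theta> n J (- A :: 'a :: {finite, field} mat) B)"
proof
  fix B
  show "lidem \<theta> n J A B = 1 / of_nat CARD('a) ^ card J * chi \<theta> n J (- A) B"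
  proof (cases "B \<in> pattern_space n J")
    case True
    then show ?thesis
      using assms by (simp add: lidem_def chi_frob linear_char_cnj frob_uminus_left)
  qed (simp add: lidem_def chi_def)
qed

section \<open>The action of root elements on lidempotents\<close>

text \<open>These are the features of J(s) and L(s) on which the action depends. The last two
  conditions make V_J stable under right multiplication by U_K and left multiplication by U_L;
  disjointness makes the factorization over U_J and U_L unique.\<close>

locale pattern_pair =
  fixes n :: nat and J L :: "(nat \<times> nat) set"
  assumes J_roots: "J \<subseteq> neg_roots n" and L_roots: "L \<subseteq> neg_roots n"
    and disjoint: "J \<inter> L = {}"
    and J_right: "(a, b) \<in> J \<Longrightarrow> (b, c) \<in> J \<union> L \<Longrightarrow> (a, c) \<in> J"
    and L_left: "(a, b) \<in> L \<Longrightarrow> (b, c) \<in> J \<Longrightarrow> (a, c) \<in> J"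
begin

lemma J_square: "J \<subseteq> {..<n} \<times> {..<n}"
  using J_roots by (auto simp: neg_roots_def)

text \<open>The product is E + Y + (X + XY) with X + XY in V_J, so its entries at positions in L
  recover Y. This gives the uniqueness that the definite description in \<open>projL\<close>
  requires.\<close>

lemma projL_eq:
  fixes X Y :: "'a :: field mat"
  assumes X: "X \<in> pattern_space n J" and Y: "Y \<in> pattern_space n L"
  shows "projL n J L ((1\<^sub>m n + X) * (1\<^sub>m n + Y)) = 1\<^sub>m n + Y"
proof -
  have mult: "\<exists>Z \<in> pattern_space n J. (1\<^sub>m n + X) * (1\<^sub>m n + Y) = 1\<^sub>m n + Y + Z"
    if X: "X \<in> pattern_space n J" and Y: "Y \<in> pattern_space n L" for X Y :: "'a mat"
  proof -
    note carr = pattern_space_carrier[OF X] pattern_space_carrier[OF Y]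
    have "X + X * Y \<in> pattern_space n J"
      using X Y J_right by (intro pattern_space_add pattern_space_mult[OF X Y]) auto
    moreover have "1\<^sub>m n + X + (Y + Z) = 1\<^sub>m n + Y + (X + Z)" if "Z \<in> carrier_mat n n" for Z
      using carr that by (intro eq_matI) (auto simp: ac_simps)
    then have "(1\<^sub>m n + X) * (1\<^sub>m n + Y) = 1\<^sub>m n + Y + (X + X * Y)"
      using carr by (simp add: add_mult_distrib_mat[of _ n n _ _ n] mult_add_distrib_mat[of _ n n _ n])
    ultimately show ?thesis by blast
  qed
  have unique: "h = 1\<^sub>m n + Y"
    if h: "h \<in> pattern_group n L" and u: "u \<in> pattern_group n J"
      and eq: "(1\<^sub>m n + X) * (1\<^sub>m n + Y) = u * h" for h u
  proof -
    obtain Y' where Y': "Y' \<in> pattern_space n L" "h = 1\<^sub>m n + Y'"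
      using h by (auto simp: pattern_group_def)
    obtain X' where X': "X' \<in> pattern_space n J" "u = 1\<^sub>m n + X'"
      using u by (auto simp: pattern_group_def)
    obtain Z Z' where Z: "Z \<in> pattern_space n J" "Z' \<in> pattern_space n J"
      and eq': "1\<^sub>m n + Y + Z = 1\<^sub>m n + Y' + Z'"
      using mult[OF X Y] mult[OF X'(1) Y'(1)] eq X'(2) Y'(2) by metis
    note carr = Z[THEN pattern_space_carrier] Y[THEN pattern_space_carrier]
      Y'(1)[THEN pattern_space_carrier]
    have "Y = Y'"
    proof (rule eq_matI)
      fix a b assume "a < dim_row Y'" "b < dim_col Y'"
      then have ab: "a < n" "b < n" using carr by auto
      \<comment> \<open>At positions in L both Z and Z' vanish, as L and J are disjoint; at all
        other positions Y and Y' vanish.\<close>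
      have "Y $$ (a, b) + Z $$ (a, b) = Y' $$ (a, b) + Z' $$ (a, b)"
        using arg_cong[OF eq', of "\<lambda>M. M $$ (a, b)"] ab carr by (simp add: add.assoc)
      moreover have "(a, b) \<in> L \<Longrightarrow> (a, b) \<notin> J" using disjoint by blast
      ultimately show "Y $$ (a, b) = Y' $$ (a, b)"
        using Z Y Y'(1) ab
        by (cases "(a, b) \<in> L") (auto simp: pattern_space_outside)
    qed (use carr in auto)
    then show ?thesis using Y'(2) by simp
  qed
  have Y_in: "1\<^sub>m n + Y \<in> pattern_group n L" and X_in: "1\<^sub>m n + X \<in> pattern_group n J"
    using X Y by (auto simp: pattern_group_def)
  show ?thesis
    unfolding projL_def using unique X_in Y_in by (intro the_equality) blast+
qed

text \<open>A root element is one of the two factors in U_J and U_L, and the other factor is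
  E.\<close>

lemma projL_root_elt:
  assumes "(i, j) \<in> J \<union> L"
  shows "projL n J L (root_elt n i j \<alpha>) = (if (i, j) \<in> L then root_elt n i j \<alpha> else 1\<^sub>m n)"
proof (cases "(i, j) \<in> L")
  case True
  then show ?thesis
    using projL_eq[OF pattern_space_zero smult_matrix_unit_pattern[OF True, where \<alpha> = \<alpha>]]
    by (simp add: root_elt_def matrix_unit_def)
next
  case False
  then have ij: "(i, j) \<in> J" using assms by auto
  show ?thesis
    using projL_eq[OF smult_matrix_unit_pattern[OF ij, where \<alpha> = \<alpha>] pattern_space_zero] False
    by (simp add: root_elt_def matrix_unit_def)
qed

section \<open>Stability of V_J under multiplication by root elements\<close>

lemma root_elt_mult_right_pattern:
  assumes B: "B \<in> pattern_space n J" and ij: "(i, j) \<in> J \<union> L"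
  shows "B * root_elt n i j \<alpha> \<in> pattern_space n J"
proof -
  have "B * (\<alpha> \<cdot>\<^sub>m matrix_unit n i j) \<in> pattern_space n J"
    using J_right by (intro pattern_space_mult[OF B smult_matrix_unit_pattern[OF ij]])
  moreover have "B * root_elt n i j \<alpha> = B + B * (\<alpha> \<cdot>\<^sub>m matrix_unit n i j)"
    using pattern_space_carrier[OF B]
    by (simp add: root_elt_def mult_add_distrib_mat[of _ n n _ n])
  ultimately show ?thesis using B by (simp add: pattern_space_add)
qed

lemma root_elt_mult_left_pattern:
  assumes B: "B \<in> pattern_space n J" and ij: "(i, j) \<in> L"
  shows "root_elt n i j \<alpha> * B \<in> pattern_space n J"
proof -
  have "\<alpha> \<cdot>\<^sub>m matrix_unit n i j * B \<in> pattern_space n J"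
    using L_left by (intro pattern_space_mult[OF smult_matrix_unit_pattern[OF ij] B])
  moreover have "root_elt n i j \<alpha> * B = B + \<alpha> \<cdot>\<^sub>m matrix_unit n i j * B"
    using pattern_space_carrier[OF B]
    by (simp add: root_elt_def add_mult_distrib_mat[of _ n n _ _ n])
  ultimately show ?thesis using B by (simp add: pattern_space_add)
qed

text \<open>The lidempotent is a multiple of the character with index -A. Acting on it yields the
  value of this character at the cocycle, times a character whose index arises by moving both
  multiplications to the other side of the trace form. The transposes account for the swapped
  indices j, i.\<close>

lemma act_lidem_root_elt:
  fixes \<theta> :: "'a :: {finite, field} \<Rightarrow> complex" and A :: "'a mat"
  assumes ij: "(i, j) \<in> J \<union> L" and \<theta>: "linear_char UNIV \<theta>" and A: "A \<in> carrier_mat n n"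
  shows "act n J L (lidem \<theta> n J A) (root_elt n i j \<alpha>) =
    (\<lambda>X. (if (i, j) \<in> L then 1 else \<theta> (A $$ (i, j) * \<alpha>)) *
      lidem \<theta> n J (pattern_trunc n J
        ((if (i, j) \<in> L then root_elt n j i \<alpha> else 1\<^sub>m n) * (A * root_elt n j i (- \<alpha>)))) X)"
proof -
  let ?V = "pattern_space n J :: 'a mat set" and ?g = "root_elt n i j \<alpha>"
  \<comment> \<open>With g the root element, k is its inverse, h = \<rho>(g), and C below is the
    cocycle f(k).\<close>
  define k where "k = root_elt n i j (- \<alpha>)"
  define h where "h = (if (i, j) \<in> L then ?g else 1\<^sub>m n)"
  define C where "C = h * k - 1\<^sub>m n"
  define q where "q = (1 :: complex) / of_nat CARD('a) ^ card J"
  \<comment> \<open>Pullback along the affine map B -> hBk + C is linear and sends a linear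
    character \<chi> to \<chi>(C) times B -> \<chi>(hBk). It witnesses that an operator as
    prescribed exists.\<close>
  define T where "T = (\<lambda>\<tau> B. if B \<in> ?V then \<tau> (h * B * k + C) else (0 :: complex))"
  \<comment> \<open>S is the operator that \<open>act\<close> chooses. Its values on multiples of
    linear characters are forced, and no others are used.\<close>
  define S where "S = (SOME T. is_act_op n J L ?g T)"
  define A' where "A' = pattern_trunc n J (h\<^sup>T * (A * k\<^sup>T))"
  have ij': "i < n" "j < n" "i \<noteq> j"
    using ij J_roots L_roots by (auto simp: neg_roots_def)
  have carr: "h \<in> carrier_mat n n" "k \<in> carrier_mat n n" by (auto simp: h_def k_def)
  have minv_g: "minv n ?g = k" "minv n k = ?g"
    using minv_root_elt[OF ij', of \<alpha>] minv_root_elt[OF ij', of "- \<alpha>"] by (simp_all add: k_def)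
  have circ: "circ n J L B k = h * B * k" for B
    unfolding circ_def minv_g projL_root_elt[OF ij] by (simp add: h_def)
  have cocycle: "cocycle n J L k = C"
    unfolding cocycle_def minv_g projL_root_elt[OF ij] by (simp add: h_def C_def)
  have hBk: "h * B * k \<in> ?V" if B: "B \<in> ?V" for B
  proof -
    have "h * B \<in> ?V"
      using B root_elt_mult_left_pattern[OF B] pattern_space_carrier[OF B] by (simp add: h_def)
    then show ?thesis unfolding k_def by (rule root_elt_mult_right_pattern[OF _ ij])
  qed
  \<comment> \<open>For (i,j) in L the projection h is g itself and cancels against k; otherwise h =
    E and C = k - E. Hence a scalar arises only for (i,j) in J.\<close>
  have C_eq: "C = (if (i, j) \<in> L then 0\<^sub>m n n else (- \<alpha>) \<cdot>\<^sub>m matrix_unit n i j)"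
  proof (cases "(i, j) \<in> L")
    case True
    then show ?thesis
      using root_elt_inverse[OF ij', of \<alpha>] by (simp add: C_def h_def k_def minus_r_inv_mat)
  next
    case False
    then have "C = k - 1\<^sub>m n" using carr by (simp add: C_def h_def)
    also have "\<dots> = (- \<alpha>) \<cdot>\<^sub>m matrix_unit n i j"
      by (rule eq_matI) (auto simp: k_def root_elt_def matrix_unit_def)
    finally show ?thesis using False by simp
  qed
  have C: "C \<in> ?V"
    using ij by (auto simp: C_eq pattern_space_zero smult_matrix_unit_pattern)
  have "is_act_op n J L ?g T"
    unfolding is_act_op_def Let_def minv_g cocycle char_dot_def circ
    using hBk C
    by (auto simp: T_def group_alg_def linear_char_def pattern_space_add fun_eq_iff)
  then have S: "is_act_op n J L ?g S" unfolding S_def by (rule someI[of "is_act_op n J L ?g"])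
  have S_scale: "S (\<lambda>B. c * \<tau> B) = (\<lambda>B. c * S \<tau> B)" if "\<tau> \<in> group_alg ?V" for c \<tau>
    using S that unfolding is_act_op_def Let_def by blast
  have S_char: "S \<chi> = (\<lambda>B. \<chi> C * (if B \<in> ?V then \<chi> (h * B * k) else 0))"
    if "\<chi> \<in> group_alg ?V" "linear_char ?V \<chi>" for \<chi>
    using S that unfolding is_act_op_def Let_def minv_g cocycle char_dot_def circ by blast
  \<comment> \<open>The sign of the index -A cancels the sign of C, which leaves A_ij
    \<alpha>.\<close>
  have chi_C: "chi \<theta> n J (- A) C = (if (i, j) \<in> L then 1 else \<theta> (A $$ (i, j) * \<alpha>))"
  proof -
    have "frob n A (0\<^sub>m n n) = 0" by (simp add: frob_def)
    then have "frob n A C = (if (i, j) \<in> L then 0 else - (A $$ (i, j) * \<alpha>))"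
      using ij' by (simp add: C_eq frob_smult_right frob_matrix_unit)
    then show ?thesis
      using A by (simp add: chi_frob[OF J_square C] frob_uminus_left linear_char_UNIV_zero[OF \<theta>])
  qed
  have A': "A' \<in> carrier_mat n n"
    unfolding A'_def by (rule pattern_trunc_in[THEN pattern_space_carrier])
  have chi_hBk: "(if B \<in> ?V then chi \<theta> n J (- A) (h * B * k) else 0) = chi \<theta> n J (- A') B" for B
  proof (cases "B \<in> ?V")
    case True
    note B = pattern_space_carrier[OF True]
    have "frob n A (h * B * k) = frob n (A * k\<^sup>T) (h * B)"
      using A B carr by (intro frob_mult_right) auto
    also have "\<dots> = frob n (h\<^sup>T * (A * k\<^sup>T)) B"
      using A B carr by (intro frob_mult_left) auto
    also have "\<dots> = frob n A' B"
      unfolding A'_def by (simp add: frob_pattern_trunc[OF True])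
    finally show ?thesis
      using True
      by (simp add: chi_frob[OF J_square True] chi_frob[OF J_square hBk[OF True]]
          frob_uminus_left[OF A] frob_uminus_left[OF A'])
  qed (simp add: chi_def)
  have "act n J L (lidem \<theta> n J A) ?g = S (\<lambda>B. q * chi \<theta> n J (- A) B)"
    unfolding act_def S_def[symmetric] lidem_eq_chi[OF J_square \<theta> A] q_def ..
  also have "\<dots> = (\<lambda>B. q * (chi \<theta> n J (- A) C * chi \<theta> n J (- A') B))"
    unfolding S_scale[OF chi_in_group_alg]
      S_char[OF chi_in_group_alg linear_char_chi[OF J_square \<theta>]] chi_hBk ..
  also have "\<dots> = (\<lambda>B. chi \<theta> n J (- A) C * lidem \<theta> n J A' B)"
    unfolding lidem_eq_chi[OF J_square \<theta> A'] q_def by (simp add: mult_ac)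
  also have "A' = pattern_trunc n J
      ((if (i, j) \<in> L then root_elt n j i \<alpha> else 1\<^sub>m n) * (A * root_elt n j i (- \<alpha>)))"
    by (simp add: A'_def h_def k_def transpose_root_elt)
  finally show ?thesis unfolding chi_C .
qed

end

section \<open>Tableaux\<close>

text \<open>By induction on the composition: the top row receives the first m numbers, and the
  remaining rows are a copy of the smaller diagram moved down by one row, with entries raised by
  m.\<close>

lemma bij_betw_initial_tableau:
  "bij_betw (initial_tableau lam) (diagram lam) {..<sum_list lam}"
proof (induction lam)
  case Nil
  then show ?case by (simp add: diagram_def bij_betw_def)
next
  case (Cons m lam)
  let ?shift = "\<lambda>(r, c). (Suc r, c)"
  have split: "diagram (m # lam) = {0} \<times> {..<m} \<union> ?shift ` diagram lam"
  proof (rule Set.set_eqI)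
    fix x :: "nat \<times> nat"
    show "x \<in> diagram (m # lam) \<longleftrightarrow> x \<in> {0} \<times> {..<m} \<union> ?shift ` diagram lam"
      by (cases x; cases "fst x") (auto simp: diagram_def image_iff)
  qed
  have first: "bij_betw (initial_tableau (m # lam)) ({0} \<times> {..<m}) {..<m}"
    by (rule bij_betw_byWitness[where f' = "\<lambda>c. (0, c)"]) (auto simp: initial_tableau_def)
  have "bij_betw ((+) m \<circ> initial_tableau lam) (diagram lam) ((+) m ` {..<sum_list lam})"
    by (intro bij_betw_trans[OF Cons.IH] bij_betw_imageI) auto
  moreover have "(+) m \<circ> initial_tableau lam = initial_tableau (m # lam) \<circ> ?shift"
    by (auto simp: initial_tableau_def)
  moreover have "(+) m ` {..<sum_list lam} = {m..<sum_list (m # lam)}"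
    by (simp add: lessThan_atLeast0 add.commute)
  ultimately have "bij_betw (initial_tableau (m # lam) \<circ> ?shift) (diagram lam)
      {m..<sum_list (m # lam)}"
    by simp
  then have rest: "bij_betw (initial_tableau (m # lam)) (?shift ` diagram lam) {m..<sum_list (m # lam)}"
    by (subst bij_betw_comp_iff[of ?shift, where A' = "?shift ` diagram lam"])
      (auto intro!: bij_betw_imageI inj_onI)
  have "{..<m} \<union> {m..<sum_list (m # lam)} = {..<sum_list (m # lam)}"
    by auto
  then show ?case
    using bij_betw_combine[OF first rest] unfolding split by (simp add: ivl_disj_int)
qed

text \<open>The permutation sought is the inverse of the initial tableau followed by s, extended by
  the identity. It is unique because the initial tableau reaches every number below n and
  permutations of that set fix all others.\<close>

lemma tab_perm_permutes:
  assumes "is_tableau lam s"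
  shows "tab_perm lam s permutes {..<sum_list lam}"
proof -
  let ?N = "{..<sum_list lam}" and ?t = "initial_tableau lam"
  define P where "P d \<longleftrightarrow> d permutes ?N \<and> (\<forall>b \<in> diagram lam. d (?t b) = s b)" for d
  define d where "d = (\<lambda>x. if x \<in> ?N then s (the_inv_into (diagram lam) ?t x) else x)"
  note t = bij_betw_initial_tableau[of lam]
  have "bij_betw (s \<circ> the_inv_into (diagram lam) ?t) ?N ?N"
    using assms by (intro bij_betw_trans[OF bij_betw_the_inv_into[OF t]]) (simp add: is_tableau_def)
  then have "bij_betw d ?N ?N"
    by (rule iffD1[OF bij_betw_cong, rotated]) (simp add: d_def)
  then have "d permutes ?N"
    by (rule bij_imp_permutes) (simp add: d_def)
  moreover have "d (?t b) = s b" if "b \<in> diagram lam" for b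
    using that bij_betwE[OF t] the_inv_into_f_f[OF bij_betw_imp_inj_on[OF t]]
    by (simp add: d_def)
  ultimately have d: "P d" by (simp add: P_def)
  have "d' = d" if d': "P d'" for d'
  proof
    fix x
    show "d' x = d x"
    proof (cases "x \<in> ?N")
      case True
      then obtain b where "b \<in> diagram lam" "x = ?t b"
        using bij_betw_imp_surj_on[OF t] by blast
      then show ?thesis using d d' by (simp add: P_def)
    next
      case False
      then show ?thesis using d d' permutes_not_in unfolding P_def by metis
    qed
  qed
  with d have "tab_perm lam s = d"
    unfolding tab_perm_def P_def[symmetric] by (rule the_equality)
  with d show ?thesis by (simp add: P_def)
qed

text \<open>Bijectivity of s gives each entry exactly one box, so \<open>tab_row\<close> is well
  defined. The bound identifies the lowest compartment as the one with no row below it.\<close>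

lemma tab_row_less_length:
  assumes s: "is_tableau lam s" and i: "i < sum_list lam"
  shows "tab_row lam s i < length lam"
proof -
  obtain r c where rc: "(r, c) \<in> diagram lam" "s (r, c) = i"
    using s i unfolding is_tableau_def bij_betw_def by (metis imageE lessThan_iff surj_pair)
  have "tab_row lam s i = r"
    unfolding tab_row_def
    using rc s unfolding is_tableau_def bij_betw_def
    by (intro the_equality) (auto dest: inj_onD)
  then show ?thesis using rc by (simp add: diagram_def)
qed

text \<open>All closure conditions reduce to transitivity of the order on entries and on row
  indices.\<close>

lemma pattern_pair_tableau: "pattern_pair (sum_list lam) (J_set lam s) (L_set lam s)"
  by standard (auto simp: J_set_def L_set_def neg_roots_def)

section \<open>Left multiplication by the permutation matrix of d\<close>

lemma tab_matrix_carrier [simp]: "tab_matrix lam s \<in> carrier_mat (sum_list lam) (sum_list lam)"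
  by (simp add: tab_matrix_def perm_matrix_def)

lemma dim_tab_matrix [simp]:
  "dim_row (tab_matrix lam s) = sum_list lam" "dim_col (tab_matrix lam s) = sum_list lam"
  by (simp_all add: tab_matrix_def perm_matrix_def)

text \<open>Row a of the permutation matrix has its only 1 in column d(a). So row a of dB is the row
  of B with label d(a).\<close>

lemma tab_matrix_mult_index:
  assumes s: "is_tableau lam s" and B: "B \<in> carrier_mat (sum_list lam) (sum_list lam)"
    and ab: "a < sum_list lam" "b < sum_list lam"
  shows "(tab_matrix lam s * B) $$ (a, b) = B $$ (tab_perm lam s a, b)"
proof -
  have d: "tab_perm lam s a < sum_list lam"
    using permutes_in_image[OF tab_perm_permutes[OF s], of a] ab by simp
  have "(tab_matrix lam s * B) $$ (a, b) =
      (\<Sum>c<sum_list lam. (if c = tab_perm lam s a then 1 else 0) * B $$ (c, b))"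
    using B ab by (simp add: tab_matrix_def perm_matrix_def scalar_prod_def atLeast0LessThan)
  also have "\<dots> = (\<Sum>c<sum_list lam. if c = tab_perm lam s a then B $$ (c, b) else 0)"
    by (intro sum.cong) auto
  also have "\<dots> = B $$ (tab_perm lam s a, b)" using d by simp
  finally show ?thesis .
qed

text \<open>Since d is onto, every row of B can be read off as some row of dB.\<close>

lemma tab_matrix_mult_inj:
  assumes s: "is_tableau lam s"
    and B: "B \<in> carrier_mat (sum_list lam) (sum_list lam)"
    and C: "C \<in> carrier_mat (sum_list lam) (sum_list lam)"
    and eq: "tab_matrix lam s * B = tab_matrix lam s * C"
  shows "B = C"
proof (rule eq_matI)
  fix a b assume "a < dim_row C" "b < dim_col C"
  then have ab: "a < sum_list lam" "b < sum_list lam" using C by auto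
  note d = tab_perm_permutes[OF s]
  obtain a' where a': "a' < sum_list lam" "tab_perm lam s a' = a"
    using permutes_image[OF d] ab(1) by (metis imageE lessThan_iff)
  show "B $$ (a, b) = C $$ (a, b)"
    using arg_cong[OF eq, of "\<lambda>M. M $$ (a', b)"] a' ab
    by (simp add: tab_matrix_mult_index[OF s B] tab_matrix_mult_index[OF s C])
qed (use B C in auto)

lemma left_mult_apply:
  assumes "inj_on ((*) D) V" "B \<in> V"
  shows "left_mult V D \<tau> (D * B) = \<tau> B"
proof -
  have "{C. C \<in> V \<and> D * C = D * B} = {B}" using assms by (auto dest: inj_onD)
  then show ?thesis by (simp add: left_mult_def)
qed

text \<open>The value at B in V is recovered at DB, and outside V elements of the group algebra
  vanish. This justifies the inverse used in \<open>act_tab\<close>.\<close>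

lemma inj_on_left_mult:
  assumes "inj_on ((*) D) V"
  shows "inj_on (left_mult V D) (group_alg V)"
proof (rule inj_onI, rule ext)
  fix \<sigma> \<tau> B
  assume *: "\<sigma> \<in> group_alg V" "\<tau> \<in> group_alg V" and eq: "left_mult V D \<sigma> = left_mult V D \<tau>"
  show "\<sigma> B = \<tau> B"
  proof (cases "B \<in> V")
    case True
    then show ?thesis
      using fun_cong[OF eq, of "D * B"] by (simp add: left_mult_apply[OF assms])
  next
    case False
    then show ?thesis using * by (simp add: group_alg_def)
  qed
qed

lemma left_mult_scale: "left_mult V D (\<lambda>B. c * \<tau> B) = (\<lambda>X. c * left_mult V D \<tau> X)"
  by (simp add: left_mult_def sum_distrib_left)

text \<open>The lidempotent lies in the group algebra, where the transport is injective, so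
  transporting it back undoes the first transport.\<close>

lemma act_tab_lidem_tab:
  fixes A :: "'a :: {finite, field} mat"
  assumes s: "is_tableau lam s"
  shows "act_tab lam s (lidem_tab \<theta> lam s A) g =
    left_mult (pattern_space (sum_list lam) (J_set lam s)) (tab_matrix lam s)
      (act (sum_list lam) (J_set lam s) (L_set lam s)
        (lidem \<theta> (sum_list lam) (J_set lam s) A) g)"
proof -
  have "inj_on ((*) (tab_matrix lam s)) (pattern_space (sum_list lam) (J_set lam s) :: 'a mat set)"
    using tab_matrix_mult_inj[OF s] by (intro inj_onI) (auto dest: pattern_space_carrier)
  note inj_on_left_mult[OF this]
  moreover have "lidem \<theta> (sum_list lam) (J_set lam s) A
      \<in> group_alg (pattern_space (sum_list lam) (J_set lam s))"
    by (simp add: group_alg_def lidem_def chi_def)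
  ultimately show ?thesis
    by (simp add: act_tab_def lidem_tab_def Let_def the_inv_into_f_f)
qed

text \<open>\<open>lab_trunc\<close> tests J at the label d(a) of row a, which is where the entry
  stood in A before the rows were permuted.\<close>

lemma lab_trunc_mult:
  assumes s: "is_tableau lam s" and A: "A \<in> carrier_mat (sum_list lam) (sum_list lam)"
  shows "lab_trunc lam s (tab_matrix lam s * A) =
    tab_matrix lam s * pattern_trunc (sum_list lam) (J_set lam s) A"
proof -
  let ?B = "pattern_trunc (sum_list lam) (J_set lam s) A"
  have B: "?B \<in> carrier_mat (sum_list lam) (sum_list lam)" by (simp add: pattern_trunc_def)
  have d: "tab_perm lam s a < sum_list lam" if "a < sum_list lam" for a
    using permutes_in_image[OF tab_perm_permutes[OF s], of a] that by simp
  show ?thesis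
  proof (rule eq_matI)
    fix a b assume "a < dim_row (tab_matrix lam s * ?B)" "b < dim_col (tab_matrix lam s * ?B)"
    then have ab: "a < sum_list lam" "b < sum_list lam" using B by auto
    show "lab_trunc lam s (tab_matrix lam s * A) $$ (a, b) = (tab_matrix lam s * ?B) $$ (a, b)"
      unfolding tab_matrix_mult_index[OF s B ab]
      using ab d by (simp add: lab_trunc_def pattern_trunc_def tab_matrix_mult_index[OF s A]
          del: index_mult_mat(1))
  qed (use B in \<open>auto simp: lab_trunc_def\<close>)
qed

text \<open>Column operations are right multiplications and so commute with left multiplication by
  d.\<close>

lemma lab_addcol_mult:
  assumes A: "A \<in> carrier_mat (sum_list lam) (sum_list lam)" and j: "j < sum_list lam"
  shows "lab_addcol c j i (tab_matrix lam s * A) = tab_matrix lam s * addcol c i j A"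
proof -
  have "lab_addcol c j i (tab_matrix lam s * A) =
      tab_matrix lam s * A * addrow_mat (sum_list lam) c j i"
    unfolding lab_addcol_def by (rule addcol_mat[OF mult_carrier_mat[OF tab_matrix_carrier A] j])
  also have "\<dots> = tab_matrix lam s * (A * addrow_mat (sum_list lam) c j i)"
    by (rule assoc_mult_mat[OF tab_matrix_carrier A addrow_mat_carrier])
  also have "A * addrow_mat (sum_list lam) c j i = addcol c i j A"
    using A j by (rule addcol_mat[symmetric])
  finally show ?thesis .
qed

lemma lab_addrow_mult:
  assumes s: "is_tableau lam s" and A: "A \<in> carrier_mat (sum_list lam) (sum_list lam)"
    and ij: "i < sum_list lam" "j < sum_list lam"
  shows "lab_addrow lam s c i j (tab_matrix lam s * A) = tab_matrix lam s * addrow c j i A"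
proof -
  let ?n = "sum_list lam" and ?d = "tab_perm lam s" and ?D = "tab_matrix lam s"
    and ?e = "inv_into UNIV (tab_perm lam s)"
  note d = tab_perm_permutes[OF s]
  have d_less: "?d a < ?n" "?e a < ?n" if "a < ?n" for a
    using permutes_in_image[OF d, of a] permutes_in_image[OF permutes_inv[OF d], of a] that
    by simp_all
  have R: "addrow c j i A \<in> carrier_mat ?n ?n" using A by simp
  show ?thesis
  proof (rule eq_matI)
    fix a b assume "a < dim_row (?D * addrow c j i A)" "b < dim_col (?D * addrow c j i A)"
    then have ab: "a < ?n" "b < ?n"
      using A by auto
    \<comment> \<open>The target row of dA is the one whose label is j; this matches the case
      distinctions of the two row operations.\<close>
    have "?e j = a \<longleftrightarrow> j = ?d a"
      using permutes_inverses[OF d] by metis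
    then show "lab_addrow lam s c i j (?D * A) $$ (a, b) = (?D * addrow c j i A) $$ (a, b)"
      using A ab ij d_less permutes_inverses(1)[OF d, of i]
      by (simp add: lab_addrow_def tab_matrix_mult_index[OF s A] tab_matrix_mult_index[OF s R]
          del: index_mult_mat(1))
  qed (use A in \<open>simp_all add: lab_addrow_def\<close>)
qed

theorem theorem5p7:
  fixes lam :: "nat list" and n :: nat and s :: "nat \<times> nat \<Rightarrow> nat"
    and \<theta> :: "'a :: {finite, field} \<Rightarrow> complex" and i j :: nat and \<alpha> :: 'a and A :: "'a mat"
  assumes "sum_list lam = n"
    and "row_standard lam s"
    and "linear_char UNIV \<theta>" and "\<exists>x. \<theta> x \<noteq> 1"
    and "(i, j) \<in> K_set lam s"
    and "A \<in> pattern_space n (J_set lam s)"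
  shows
    "((i, j) \<in> J_set lam s \<longrightarrow>
        (\<exists>B \<in> pattern_space n (J_set lam s).
          tab_matrix lam s * B
            = lab_trunc lam s (lab_addcol (- \<alpha>) j i (tab_matrix lam s * A)) \<and>
          act_tab lam s (lidem_tab \<theta> lam s A) (root_elt n i j \<alpha>)
            = (\<lambda>X. \<theta> (A $$ (i, j) * \<alpha>) * lidem_tab \<theta> lam s B X))) \<and>
     ((i, j) \<in> L_set lam s \<longrightarrow>
        (\<exists>B \<in> pattern_space n (J_set lam s).
          tab_matrix lam s * B
            = lab_trunc lam s
                (lab_addrow lam s \<alpha> i j (lab_addcol (- \<alpha>) j i (tab_matrix lam s * A))) \<and>
          act_tab lam s (lidem_tab \<theta> lam s A) (root_elt n i j \<alpha>) = lidem_tab \<theta> lam s B)) \<and>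
     ((i, j) \<in> L_set lam s \<and> tab_row lam s i = 0 \<and> tab_row lam s j = 0 \<longrightarrow>
        (\<exists>B \<in> pattern_space n (J_set lam s).
          tab_matrix lam s * B
            = lab_trunc lam s (lab_addcol (- \<alpha>) j i (tab_matrix lam s * A)) \<and>
          act_tab lam s (lidem_tab \<theta> lam s A) (root_elt n i j \<alpha>) = lidem_tab \<theta> lam s B)) \<and>
     ((i, j) \<in> L_set lam s
        \<and> Suc (tab_row lam s i) = length lam \<and> Suc (tab_row lam s j) = length lam \<longrightarrow>
        (\<exists>B \<in> pattern_space n (J_set lam s).
          tab_matrix lam s * B
            = lab_trunc lam s (lab_addrow lam s \<alpha> i j (tab_matrix lam s * A)) \<and>
          act_tab lam s (lidem_tab \<theta> lam s A) (root_elt n i j \<alpha>) = lidem_tab \<theta> lam s B))"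
proof -
  let ?J = "J_set lam s" and ?L = "L_set lam s" and ?D = "tab_matrix lam s :: 'a mat"
  let ?V = "pattern_space n ?J :: 'a mat set" and ?g = "root_elt n i j \<alpha>"
  have n: "n = sum_list lam" using assms(1) by simp
  have s: "is_tableau lam s" using assms(2) by (simp add: row_standard_def)
  interpret pattern_pair n ?J ?L unfolding n by (rule pattern_pair_tableau)
  have ij: "(i, j) \<in> ?J \<union> ?L" using assms(5) by (simp add: K_set_def)
  then have ij_less: "i < n" "j < n" using J_roots L_roots by (auto simp: neg_roots_def)
  have A: "A \<in> carrier_mat n n" using assms(6) by (rule pattern_space_carrier)
  let ?col = "addcol (- \<alpha>) i j"
  \<comment> \<open>The transposed root element x_ji acts on the right by adding column j to column
    i, and on the left by adding row i to row j, which are the required directions.\<close>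
  have col: "?col A = A * root_elt n j i (- \<alpha>)" "?col A \<in> carrier_mat n n"
    using root_elt_mult_right[OF A ij_less(2)] A by (simp_all add: mat_addcol_def)
  have row: "addrow \<alpha> j i M = root_elt n j i \<alpha> * M" "addrow \<alpha> j i M \<in> carrier_mat n n"
    if "M \<in> carrier_mat n n" for M
    using root_elt_mult_left[OF that ij_less(1)] that by simp_all
  have lab_col: "lab_addcol (- \<alpha>) j i (?D * A) = ?D * ?col A"
    using A ij_less(2) unfolding n by (rule lab_addcol_mult)
  have lab_row: "lab_addrow lam s \<alpha> i j (?D * M) = ?D * addrow \<alpha> j i M"
    if "M \<in> carrier_mat n n" for M
    using that ij_less unfolding n by (rule lab_addrow_mult[OF s])
  have trunc: "lab_trunc lam s (?D * M) = ?D * pattern_trunc n ?J M"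
    if "M \<in> carrier_mat n n" for M
    using that unfolding n by (rule lab_trunc_mult[OF s])
  have act: "act_tab lam s (lidem_tab \<theta> lam s A) ?g =
      (\<lambda>X. (if (i, j) \<in> ?L then 1 else \<theta> (A $$ (i, j) * \<alpha>)) *
        lidem_tab \<theta> lam s (pattern_trunc n ?J
          (if (i, j) \<in> ?L then addrow \<alpha> j i (?col A) else ?col A)) X)"
    using act_lidem_root_elt[OF ij assms(3) A, of \<alpha>] left_mult_one_mat[OF col(2)]
    unfolding act_tab_lidem_tab[OF s] n[symmetric] col(1)[symmetric]
    by (cases "(i, j) \<in> ?L")
      (simp_all add: row(1)[OF col(2)] left_mult_scale lidem_tab_def n[symmetric])
  have act_J: "act_tab lam s (lidem_tab \<theta> lam s A) ?g =
      (\<lambda>X. \<theta> (A $$ (i, j) * \<alpha>) * lidem_tab \<theta> lam s (pattern_trunc n ?J (?col A)) X)"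
    if "(i, j) \<in> ?J"
  proof -
    have "(i, j) \<notin> ?L" using disjoint that by auto
    then show ?thesis unfolding act by simp
  qed
  have act_L: "act_tab lam s (lidem_tab \<theta> lam s A) ?g =
      lidem_tab \<theta> lam s (pattern_trunc n ?J (addrow \<alpha> j i (?col A)))"
    if "(i, j) \<in> ?L"
    using that unfolding act by simp
  \<comment> \<open>No row of s lies above row 0, so row i of A is zero. The column operation keeps
    it zero, and adding it to row j has no effect.\<close>
  have top: "pattern_trunc n ?J (addrow \<alpha> j i (?col A)) = pattern_trunc n ?J (?col A)"
    if "tab_row lam s i = 0"
  proof -
    have "A $$ (i, b) = 0" if "b < n" for b
      using pattern_space_outside[OF assms(6) ij_less(1) that] \<open>tab_row lam s i = 0\<close>
      by (simp add: J_set_def)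
    then have "addrow \<alpha> j i (?col A) = ?col A"
      using A ij_less by (intro eq_matI) auto
    then show ?thesis by simp
  qed
  \<comment> \<open>No row of s lies below that of j, so column j of A is zero and adding a multiple
    of it to column i has no effect.\<close>
  have bottom: "pattern_trunc n ?J (addrow \<alpha> j i (?col A)) = pattern_trunc n ?J (addrow \<alpha> j i A)"
    if "Suc (tab_row lam s j) = length lam"
  proof -
    have "A $$ (a, j) = 0" if "a < n" for a
      using pattern_space_outside[OF assms(6) that ij_less(2)] tab_row_less_length[OF s, of a] that
        \<open>Suc (tab_row lam s j) = length lam\<close> n
      by (auto simp: J_set_def)
    then have "?col A = A"
      using A ij_less by (intro eq_matI) auto
    then show ?thesis by simp
  qed
  show ?thesis
    using pattern_trunc_in[of n ?J] act_J act_L top bottom A col(2) row(2)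
    \<comment> \<open>Every witness B is a truncation to J, which gives its membership in V_J at
      once.\<close>
    by (intro conjI impI bexI[OF _ pattern_trunc_in])
      (auto simp: lab_col lab_row trunc)
qed

end
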